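(* Let $(a_k),(b_k)$ be a Bregman alternating sequence between $A$ and $B$, with gap $(K^*,r^* )$. Let $\theta\in[\frac12,1)$, and suppose that at every $(b^*,a^* )\in K^*$ the $rl$-three-point inequality is satisfied and the $rl$-angle condition is satisfied with de-singularizing function $\phi$ given by $\phi'(s)=s^{-\theta}$. Let $b^*$ denote the limit of the (convergent) sequence $(b_k)$. (1) If $\theta\in(\frac12,1)$, then $\|b_k-b^*\|=O(k^{-\rho})$ with $\rho=\frac{1-\theta}{2\theta-1}\in(0,\infty)$. (2) If $\theta=\frac12$, then $b_k\to b^*$ with R-linear speed. (3) In the feasible case $r^*=0$, the $a_k$ converge to $b^*\in A\cap B$ with the same speed.
   Context: Setting: $f:\mathbb R^d\to\mathbb R\cup\{+\infty\}$ is a convex function of Legendre type (in Rockafellar's sense), $G:=\mathrm{int}(\mathrm{dom} f)$, $f$ is of class $C^2$ on $G$ and $\nabla^2f(x)\succ0$ for all $x\in G$. The Bregman distance is $D(x,y)=f(x)-f(y)-\langle\nabla f(y),x-y\rangle$ for $y\in G$ and $D(x,y)=+\infty$ otherwise. $A,B\subset G$ are nonempty, closed and bounded. Projections: $\overleftarrow{D}_B(a)=\min\{D(b',a):b'\in B\}$, $\overleftarrow{P}_B(a)=\mathrm{argmin}\{D(b',a):b'\in B\}$; $\overrightarrow{P}_A(b)=\mathrm{argmin}\{D(b,a'):a'\in A\}$ (set-valued). A Bregman alternating sequence is $a_k\in A$, $b_k\in B$ with $b_k\in\overleftarrow{P}_B(a_k)$, $a_{k+1}\in\overrightarrow{P}_A(b_k)$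 for all $k$. An $rl$-building block $b\to a^+\to b^+$ consists of $b\in B$, $a^+\in\overrightarrow{P}_A(b)$, $b^+\in\overleftarrow{P}_B(a^+)$. Gaps: for $b^*\in B$, $a^*\in A$ write $b^*\sim a^*$ (gap pair) if $a^*\in\overrightarrow{P}_A(b^* )$ and $b^*\in\overleftarrow{P}_B(a^* )$; its gap value is the $r^*\ge0$ with $D(b^*,a^* )=\frac12 r^{*2}$. For an alternating sequence, $D(b_k,a_k)$ decreases to a limit $\frac12r^{*2}$; with $A^*,B^*$ the sets of accumulation points of $(a_k)$, $(b_k)$, the gap of the sequence is $(K^*,r^* )$, $K^*=\{(b^*,a^* )\in B^*\times A^*: b^*\sim a^*\}$. $rl$-angle condition at a gap pair $b^*\sim a^*$ with value $r^*$ and de-singularizing function $\phi$: there exist a neighborhood $W$ of $(b^*,a^* )$ and constants $\gamma,\eta>0$ such that, with $\sigma(s)=\phi'(s)^{-2}$ if $r^*>0$ and $\sigma(s)=\phi'(s)^{-2}s^{-1}$ if $r^*=0$, $$\frac{1-\cos\alpha}{\sigma(\overleftarrow{D}_B(a^+)-\frac12r^{*2})}\ge\gamma$$ for every $rl$-building block $b\to a^+\to b^+$ with $(b^+,a^+)\in W$ and $\frac12r^{*2}<D(b^+,a^+)<\frac12r^{*2}+\eta$, where $\alpha$ is the angle between $b-a^+$ and $b^+-a^+$. Here $\phi(0)=0$, so $\phi'(s)=s^{-\theta}$ means $\phi(s)=s^{1-\theta}/(1-\theta)$. $rl$-three-point inequality at $(b^*,a^* )$: there exist $\ell\in(0,1)$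 and $\delta>0$ such that $D(b,a^+)\ge D(b^+,a^+)+\ell D(b,b^+)$ for every $rl$-building block $b\to a^+\to b^+$ with $\|b^+-b^*\|<\delta$, $\|a^+-a^*\|<\delta$. R-linear speed of $x_k\to x$ means $\|x_k-x\|\le Cq^k$ for some $C>0$, $q\in(0,1)$. *)

theory Defs
  imports "HOL-Analysis.Analysis" "HOL-Library.Landau_Symbols"
begin

subsection \<open>Legendre functions and the Bregman distance\<close>

text \<open>Functions into the reals with plus infinity adjoined are rendered as \<open>ereal\<close>-valued
  functions that never take the value \<open>-\<infinity>\<close>. The predicates for real-valued functions are applied
  to \<open>finite_part f\<close>, and only at points where \<open>f\<close> is finite.\<close>

definition edom :: "('a \<Rightarrow> ereal) \<Rightarrow> 'a set" where
  "edom f = {x. f x < \<infinity>}"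

definition finite_part :: "('a \<Rightarrow> ereal) \<Rightarrow> 'a \<Rightarrow> real" where
  "finite_part f x = real_of_ereal (f x)"

definition convex_ereal_fun :: "('a::real_vector \<Rightarrow> ereal) \<Rightarrow> bool" where
  "convex_ereal_fun f \<longleftrightarrow>
     (\<forall>x. f x \<noteq> -\<infinity>) \<and> convex {(x, t :: real). f x \<le> ereal t}"

definition gradient :: "('a::real_inner \<Rightarrow> real) \<Rightarrow> 'a \<Rightarrow> 'a" where
  "gradient g x = (THE v. GDERIV g x :> v)"

lemma gradient_eqI:
  assumes "GDERIV g x :> v"
  shows "gradient g x = v"
  unfolding gradient_def
proof (rule the_equality)
  show "GDERIV g x :> v" by (rule assms)
next
  fix w assume w: "GDERIV g x :> w"
  have "(\<lambda>h. h \<bullet> w) = (\<lambda>h. h \<bullet> v)"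
    using has_derivative_unique w assms unfolding gderiv_def by blast
  then have "h \<bullet> w = h \<bullet> v" for h by metis
  then show "w = v" using vector_eq_ldot by blast
qed

definition strictly_convex_on :: "'a::real_vector set \<Rightarrow> ('a \<Rightarrow> real) \<Rightarrow> bool" where
  "strictly_convex_on C g \<longleftrightarrow> convex C \<and>
     (\<forall>x\<in>C. \<forall>y\<in>C. \<forall>t. x \<noteq> y \<and> 0 < t \<and> t < 1 \<longrightarrow>
        g ((1 - t) *\<^sub>R x + t *\<^sub>R y) < (1 - t) * g x + t * g y)"

text \<open>Rockafellar, \<^emph>\<open>Convex Analysis\<close>, Section 26: the pair \<open>(C, g)\<close> is a convex function of
  Legendre type.\<close>

definition legendre_type :: "'a::euclidean_space set \<Rightarrow> ('a \<Rightarrow> real) \<Rightarrow> bool" where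
  "legendre_type C g \<longleftrightarrow>
     open C \<and> C \<noteq> {} \<and> strictly_convex_on C g \<and>
     (\<forall>x\<in>C. \<exists>v. GDERIV g x :> v) \<and>
     (\<forall>u z. (\<forall>i. u i \<in> C) \<and> z \<in> frontier C \<and> u \<longlonglongrightarrow> z \<longrightarrow>
        filterlim (\<lambda>i. norm (gradient g (u i))) at_top sequentially)"

definition convex_legendre :: "('a::euclidean_space \<Rightarrow> ereal) \<Rightarrow> bool" where
  "convex_legendre f \<longleftrightarrow>
     convex_ereal_fun f \<and> legendre_type (interior (edom f)) (finite_part f)"

text \<open>\<open>H x\<close> is the Hessian of \<open>g\<close> at \<open>x\<close>, regarded as a bounded linear operator: \<open>g\<close> is of class
  \<open>C\<^sup>2\<close> with positive definite Hessian.\<close>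

definition C2_posdef_on :: "'a::euclidean_space set \<Rightarrow> ('a \<Rightarrow> real) \<Rightarrow> bool" where
  "C2_posdef_on C g \<longleftrightarrow>
     (\<forall>x\<in>C. \<exists>v. GDERIV g x :> v) \<and>
     (\<exists>H :: 'a \<Rightarrow> ('a \<Rightarrow>\<^sub>L 'a). continuous_on C H \<and>
        (\<forall>x\<in>C. (gradient g has_derivative blinfun_apply (H x)) (at x) \<and>
               (\<forall>h. h \<noteq> 0 \<longrightarrow> 0 < h \<bullet> blinfun_apply (H x) h)))"

definition bregman :: "('a::euclidean_space \<Rightarrow> ereal) \<Rightarrow> 'a \<Rightarrow> 'a \<Rightarrow> ereal" where
  "bregman f x y =
     (if y \<in> interior (edom f)
      then f x - f y - ereal (gradient (finite_part f) y \<bullet> (x - y))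
      else \<infinity>)"


subsection \<open>Projections, alternating sequences, building blocks\<close>

definition left_dist :: "('a::euclidean_space \<Rightarrow> ereal) \<Rightarrow> 'a set \<Rightarrow> 'a \<Rightarrow> ereal" where
  "left_dist f B a = (INF b'\<in>B. bregman f b' a)"

definition left_proj :: "('a::euclidean_space \<Rightarrow> ereal) \<Rightarrow> 'a set \<Rightarrow> 'a \<Rightarrow> 'a set" where
  "left_proj f B a = {b. is_arg_min (\<lambda>b'. bregman f b' a) (\<lambda>b'. b' \<in> B) b}"

definition right_proj :: "('a::euclidean_space \<Rightarrow> ereal) \<Rightarrow> 'a set \<Rightarrow> 'a \<Rightarrow> 'a set" where
  "right_proj f A b = {a. is_arg_min (\<lambda>a'. bregman f b a') (\<lambda>a'. a' \<in> A) a}"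

definition alternating_sequence ::
  "('a::euclidean_space \<Rightarrow> ereal) \<Rightarrow> 'a set \<Rightarrow> 'a set \<Rightarrow> (nat \<Rightarrow> 'a) \<Rightarrow> (nat \<Rightarrow> 'a) \<Rightarrow> bool" where
  "alternating_sequence f A B a b \<longleftrightarrow>
     (\<forall>k. a k \<in> A \<and> b k \<in> B \<and> b k \<in> left_proj f B (a k) \<and> a (Suc k) \<in> right_proj f A (b k))"

definition rl_block ::
  "('a::euclidean_space \<Rightarrow> ereal) \<Rightarrow> 'a set \<Rightarrow> 'a set \<Rightarrow> 'a \<Rightarrow> 'a \<Rightarrow> 'a \<Rightarrow> bool" where
  "rl_block f A B b a' b' \<longleftrightarrow> b \<in> B \<and> a' \<in> right_proj f A b \<and> b' \<in> left_proj f B a'"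


subsection \<open>Gaps\<close>

definition gap_pair ::
  "('a::euclidean_space \<Rightarrow> ereal) \<Rightarrow> 'a set \<Rightarrow> 'a set \<Rightarrow> 'a \<Rightarrow> 'a \<Rightarrow> bool" where
  "gap_pair f A B b a \<longleftrightarrow> b \<in> B \<and> a \<in> A \<and> a \<in> right_proj f A b \<and> b \<in> left_proj f B a"

definition gap_value :: "('a::euclidean_space \<Rightarrow> ereal) \<Rightarrow> 'a \<Rightarrow> 'a \<Rightarrow> real" where
  "gap_value f b a = (THE r. 0 \<le> r \<and> bregman f b a = ereal (r\<^sup>2 / 2))"

lemma gap_value_eqI:
  assumes "0 \<le> r" "bregman f b a = ereal (r\<^sup>2 / 2)"
  shows "gap_value f b a = r"
  unfolding gap_value_def by (rule the_equality) (use assms in auto)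

definition accumulation_points :: "(nat \<Rightarrow> 'a::topological_space) \<Rightarrow> 'a set" where
  "accumulation_points u = {x. \<exists>r. strict_mono r \<and> (u \<circ> r) \<longlonglongrightarrow> x}"

text \<open>\<open>(K, r)\<close> is the gap of the alternating sequence \<open>(a, b)\<close>.\<close>

definition is_gap ::
  "('a::euclidean_space \<Rightarrow> ereal) \<Rightarrow> 'a set \<Rightarrow> 'a set \<Rightarrow> (nat \<Rightarrow> 'a) \<Rightarrow> (nat \<Rightarrow> 'a) \<Rightarrow>
     ('a \<times> 'a) set \<Rightarrow> real \<Rightarrow> bool" where
  "is_gap f A B a b K r \<longleftrightarrow>
     0 \<le> r \<and> (\<lambda>k. bregman f (b k) (a k)) \<longlonglongrightarrow> ereal (r\<^sup>2 / 2) \<and>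
     K = {(bs, as). bs \<in> accumulation_points b \<and> as \<in> accumulation_points a \<and>
                    gap_pair f A B bs as}"


subsection \<open>Angle condition and three-point inequality\<close>

definition vec_angle :: "'a::real_inner \<Rightarrow> 'a \<Rightarrow> real" where
  "vec_angle u v = arccos ((u \<bullet> v) / (norm u * norm v))"

text \<open>The desingularizing function with \<open>\<phi>(0) = 0\<close> and \<open>\<phi>'(s) = s\<^sup>-\<^sup>\<theta>\<close> for \<open>s > 0\<close>.\<close>

definition desing_power :: "real \<Rightarrow> real \<Rightarrow> real" where
  "desing_power \<theta> s = s powr (1 - \<theta>) / (1 - \<theta>)"

lemma deriv_desing_power:
  assumes "\<theta> < 1" "0 < s"
  shows "deriv (desing_power \<theta>) s = s powr (- \<theta>)"
proof -
  have "((\<lambda>s. s powr (1 - \<theta>) / (1 - \<theta>)) has_real_derivative s powr (- \<theta>)) (at s)"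
    using assms by (auto intro!: derivative_eq_intros)
  then show ?thesis
    unfolding desing_power_def by (rule DERIV_imp_deriv)
qed

definition angle_sigma :: "(real \<Rightarrow> real) \<Rightarrow> real \<Rightarrow> real \<Rightarrow> real" where
  "angle_sigma \<phi> r s =
     (if r > 0 then 1 / (deriv \<phi> s)\<^sup>2 else 1 / ((deriv \<phi> s)\<^sup>2 * s))"

text \<open>In the blocks to which the condition applies \<open>0 < D(b', a')\<close>, so \<open>b' \<noteq> a'\<close>, and also
  \<open>b \<noteq> a'\<close> (otherwise \<open>a' \<in> B\<close> and \<open>b'\<close> would be \<open>a'\<close>); hence the angle is never degenerate.\<close>

definition rl_angle_condition ::
  "('a::euclidean_space \<Rightarrow> ereal) \<Rightarrow> 'a set \<Rightarrow> 'a set \<Rightarrow> (real \<Rightarrow> real) \<Rightarrow> 'a \<Rightarrow> 'a \<Rightarrow> bool" where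
  "rl_angle_condition f A B \<phi> bs as \<longleftrightarrow>
     (let r = gap_value f bs as in
      \<exists>W \<gamma> \<eta>. open W \<and> (bs, as) \<in> W \<and> 0 < \<gamma> \<and> 0 < \<eta> \<and>
        (\<forall>b a' b'. rl_block f A B b a' b' \<and> (b', a') \<in> W \<and>
             ereal (r\<^sup>2 / 2) < bregman f b' a' \<and> bregman f b' a' < ereal (r\<^sup>2 / 2 + \<eta>) \<longrightarrow>
           (1 - cos (vec_angle (b - a') (b' - a'))) /
             angle_sigma \<phi> r (real_of_ereal (left_dist f B a') - r\<^sup>2 / 2) \<ge> \<gamma>))"

definition rl_three_point ::
  "('a::euclidean_space \<Rightarrow> ereal) \<Rightarrow> 'a set \<Rightarrow> 'a set \<Rightarrow> 'a \<Rightarrow> 'a \<Rightarrow> bool" where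
  "rl_three_point f A B bs as \<longleftrightarrow>
     (\<exists>l \<delta>. 0 < l \<and> l < 1 \<and> 0 < \<delta> \<and>
        (\<forall>b a' b'. rl_block f A B b a' b' \<and> norm (b' - bs) < \<delta> \<and> norm (a' - as) < \<delta> \<longrightarrow>
           bregman f b a' \<ge> bregman f b' a' + ereal l * bregman f b b'))"

definition R_linear :: "(nat \<Rightarrow> 'a::real_normed_vector) \<Rightarrow> 'a \<Rightarrow> bool" where
  "R_linear u x \<longleftrightarrow>
     (\<exists>C q. 0 < C \<and> 0 < q \<and> q < 1 \<and> (\<forall>k. norm (u k - x) \<le> C * q ^ k))"

end

(* Let s k = D (b k) (a k) - r^2/2, which decreases to 0, and d k = norm (b k - b (k+1)). On the
   compact convex hull of A and B the Bregman distance is comparable to the squared norm, so the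
   three-point inequality gives c * d k^2 <= s k - s (k+1). In the triangle b k, a (k+1), b (k+1)
   the cosine formula and the angle condition give c * s (k+1)^(2 \<theta>) <= d k^2. Both hold for all
   large k with one constant c, by compactness, since the accumulation points of the pairs
   (b k, a k) are gap pairs. Concavity of t^(1-\<theta>) then yields
   2 d (k+1) <= d k + E (s (k+1)^(1-\<theta>) - s (k+2)^(1-\<theta>)), hence b converges and
   norm (b (k+1) - lim b) = O(s k^(1-\<theta>)); the rate of s follows from
   c^2 s (k+1)^(2 \<theta>) <= s k - s (k+1). *)

theory Submission
  imports Defs
begin

subsection \<open>Sequences with the Kurdyka--Lojasiewicz property\<close>

text \<open>The concave function \<open>t powr p\<close> lies below its tangent at \<open>s\<close>.
  The tangent inequality is applied on the open half-line; at \<open>t = 0\<close> the claim reduces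
  to \<open>p \<le> 1\<close>.\<close>

lemma powr_concave_tangent:
  fixes s t p :: real
  assumes "0 < p" "p \<le> 1" "0 < s" "0 \<le> t"
  shows "p * s powr (p - 1) * (s - t) \<le> s powr p - t powr p"
proof (cases "t = 0")
  case True
  have "p * s powr p \<le> 1 * s powr p" using assms by (intro mult_right_mono) auto
  moreover have "s powr (p - 1) * s = s powr p" using assms by (simp add: powr_diff)
  ultimately show ?thesis using True assms by (simp add: mult.assoc)
next
  case False
  then have t: "0 < t" using assms by simp
  have 1: "convex_on {0<..} (\<lambda>x::real. - (x powr p))"
  proof (rule convex_on_realI)
    show "connected {0::real<..}" by simp
    fix x :: real assume "x \<in> {0<..}"
    then show "((\<lambda>x. - (x powr p)) has_real_derivative - (p * x powr (p - 1))) (at x)"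
      by (auto intro!: derivative_eq_intros)
  next
    fix x y :: real assume "x \<in> {0<..}" "y \<in> {0<..}" "x \<le> y"
    then show "- (p * x powr (p - 1)) \<le> - (p * y powr (p - 1))"
      using assms by (simp add: powr_mono2')
  qed
  have "- (p * s powr (p - 1)) * (t - s) \<le> - (t powr p) - - (s powr p)"
  proof (rule convex_on_imp_above_tangent[OF 1])
    show "((\<lambda>x. - (x powr p)) has_real_derivative - (p * s powr (p - 1))) (at s within {0<..})"
      using assms by (auto intro!: derivative_eq_intros)
  qed (use assms t in \<open>auto simp: interior_open\<close>)
  then show ?thesis by (simp add: algebra_simps)
qed

lemma norm_diff_le_telescope:
  fixes b :: "nat \<Rightarrow> 'a::real_normed_vector"
  assumes "\<And>k. norm (b k - b (Suc k)) \<le> V k - V (Suc k)"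
  shows "norm (b k - b (k + n)) \<le> V k - V (k + n)"
proof (induction n)
  case (Suc n)
  have "norm (b k - b (k + Suc n)) \<le> norm (b k - b (k + n)) + norm (b (k + n) - b (Suc (k + n)))"
    using norm_triangle_ineq[of "b k - b (k + n)" "b (k + n) - b (Suc (k + n))"] by simp
  also have "\<dots> \<le> V k - V (k + Suc n)"
    using Suc assms[of "k + n"] by simp
  finally show ?case .
qed simp

text \<open>A nonnegative potential \<open>V\<close> that pays for every step makes the total length
  finite, hence the sequence converges; letting \<open>n\<close> tend to infinity in the telescoped
  bound gives the distance to the limit.\<close>

lemma telescope_dominated_limit:
  fixes b :: "nat \<Rightarrow> 'a::banach"
  assumes step: "\<And>k. norm (b k - b (Suc k)) \<le> V k - V (Suc k)"
    and V0: "\<And>k. 0 \<le> V k"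
  shows "\<exists>x. b \<longlonglongrightarrow> x \<and> (\<forall>k. norm (b k - x) \<le> V k)"
proof -
  note bd = norm_diff_le_telescope[of b V, OF step]
  have "summable (\<lambda>k. norm (b (Suc k) - b k))"
  proof (rule bounded_imp_summable)
    show "(\<Sum>k\<le>n. norm (b (Suc k) - b k)) \<le> V 0" for n
    proof -
      have "(\<Sum>k\<le>n. norm (b (Suc k) - b k)) \<le> V 0 - V (Suc n)"
      proof (induction n)
        case 0 then show ?case using step[of 0] by (simp add: norm_minus_commute)
      next
        case (Suc n) then show ?case using step[of "Suc n"] by (simp add: norm_minus_commute)
      qed
      then show ?thesis using V0[of "Suc n"] by linarith
    qed
  qed auto
  then have "convergent (\<lambda>n. \<Sum>k<n. (b (Suc k) - b k))"
    unfolding summable_iff_convergent[symmetric] by (rule summable_norm_cancel)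
  then have "convergent (\<lambda>n. b n - b 0)" by (simp add: sum_lessThan_telescope)
  then obtain y where "(\<lambda>n. b n - b 0) \<longlonglongrightarrow> y" by (auto simp: convergent_def)
  then have lim: "b \<longlonglongrightarrow> y + b 0"
    using tendsto_add[of "\<lambda>n. b n - b 0" y sequentially "\<lambda>_. b 0" "b 0"] by simp
  have "norm (b k - (y + b 0)) \<le> V k" for k
  proof (rule LIMSEQ_le_const2)
    show "(\<lambda>n. norm (b k - b n)) \<longlonglongrightarrow> norm (b k - (y + b 0))"
      by (intro tendsto_intros lim)
    have "norm (b k - b n) \<le> V k" if "k \<le> n" for n
      using bd[of k "n - k"] V0[of n] that by simp
    then show "\<exists>N. \<forall>n\<ge>N. norm (b k - b n) \<le> V k" by blast
  qed
  with lim show ?thesis by blast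
qed

text \<open>Converts estimates by \<open>sqrt s\<close> into estimates by the lower power
  \<open>s powr (1 - \<theta>)\<close>: the surplus exponent \<open>1/2 - p\<close> is nonnegative,
  so that factor is bounded through \<open>T\<close>.\<close>

lemma sqrt_le_powr_half_split:
  fixes t T p :: real
  assumes "0 \<le> t" "t \<le> T" "p \<le> 1/2"
  shows "sqrt t \<le> T powr (1/2 - p) * t powr p"
proof -
  have "sqrt t = t powr (1/2 - p) * t powr p"
    using assms by (simp add: powr_half_sqrt flip: powr_add)
  also have "\<dots> \<le> T powr (1/2 - p) * t powr p"
    using assms by (intro mult_right_mono powr_mono2) auto
  finally show ?thesis .
qed

text \<open>The finite-length argument: \<open>descent\<close> bounds the square of a step by the
  drop of \<open>s\<close>, concavity bounds this drop by the drop of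
  \<open>s powr (1 - \<theta>)\<close>, and \<open>error\<close> replaces the remaining factor
  \<open>s powr \<theta>\<close> by the previous step.\<close>

lemma desingularized_length_bound:
  fixes b :: "nat \<Rightarrow> 'a::banach" and s :: "nat \<Rightarrow> real"
  assumes \<theta>: "1 / 2 \<le> \<theta>" "\<theta> < 1" and c: "0 < c" and s0: "\<And>k. 0 \<le> s k"
    and descent: "\<And>k. c * (norm (b k - b (Suc k)))\<^sup>2 \<le> s k - s (Suc k)"
    and error: "\<And>k. c * s (Suc k) powr (2 * \<theta>) \<le> (norm (b k - b (Suc k)))\<^sup>2"
  shows "\<exists>x C. b \<longlonglongrightarrow> x \<and> 0 < C \<and> (\<forall>k. norm (b (Suc k) - x) \<le> C * s k powr (1 - \<theta>))"
proof -
  define p where "p = 1 - \<theta>"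
  have p: "0 < p" "p \<le> 1/2" using \<theta> by (auto simp: p_def)
  define d where "d k = norm (b k - b (Suc k))" for k
  \<comment> \<open>Chosen so that \<open>descent\<close>, \<open>error\<close> and concavity
    combine to \<open>(d (Suc k))\<^sup>2 \<le> d k * (E * D)\<close>, with \<open>D\<close> the
    drop of \<open>s powr p\<close>.\<close>
  define E where "E = 1 / (p * c * sqrt c)"
  have E: "0 < E" using p c by (simp add: E_def)
  \<comment> \<open>With this potential, \<open>2 * d (Suc k) \<le> d k + E * D\<close> is the same
    as \<open>d (Suc k) \<le> V k - V (Suc k)\<close>. The index is shifted by one because
    \<open>error\<close> at \<open>k\<close> speaks of \<open>s (Suc k)\<close>.\<close>
  define V where "V k = d k + E * s (Suc k) powr p" for k
  have d0: "0 \<le> d k" for k by (simp add: d_def)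
  have dec: "s (Suc k) \<le> s k" for k
    using descent[of k] c by (smt (verit) mult_nonneg_nonneg zero_le_power2)
  have decn: "s k \<le> s 0" for k
    by (induction k) (use dec order_trans in auto)
  have step: "d (Suc k) \<le> V k - V (Suc k)" for k
  proof -
    define D where "D = s (Suc k) powr p - s (Suc (Suc k)) powr p"
    have D0: "0 \<le> D" using dec[of "Suc k"] s0 p by (simp add: D_def powr_mono2)
    have "(2 * d (Suc k))\<^sup>2 \<le> (d k + E * D)\<^sup>2"
    \<comment> \<open>There is no tangent slope to use when \<open>s (Suc k) = 0\<close>, but
      \<open>descent\<close> then forces the next step to vanish.\<close>
    proof (cases "s (Suc k) = 0")
      case True
      have "c * (d (Suc k))\<^sup>2 \<le> 0"
        using descent[of "Suc k"] True s0[of "Suc (Suc k)"] by (simp add: d_def)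
      then have "d (Suc k) = 0" using c by (simp add: mult_le_0_iff)
      then show ?thesis by simp
    next
      case False
      define t where "t = s (Suc k)"
      have t: "0 < t" using False s0[of "Suc k"] by (simp add: t_def)
      have "p * t powr (- \<theta>) * (c * (d (Suc k))\<^sup>2) \<le> p * t powr (- \<theta>) * (t - s (Suc (Suc k)))"
        using descent[of "Suc k"] p t by (intro mult_left_mono) (auto simp: t_def d_def)
      also have "\<dots> \<le> D"
        using powr_concave_tangent[of p t "s (Suc (Suc k))"] p t s0 by (simp add: D_def t_def p_def)
      finally have "t powr \<theta> * (p * t powr (- \<theta>) * (c * (d (Suc k))\<^sup>2)) \<le> t powr \<theta> * D"
        by (intro mult_left_mono) auto
      moreover have "t powr \<theta> * t powr (- \<theta>) = 1" using t by (simp add: powr_minus)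
      ultimately have 1: "p * (c * (d (Suc k))\<^sup>2) \<le> t powr \<theta> * D"
        by (metis (no_types, lifting) mult.assoc mult.commute mult_1)
      have "sqrt (c * t powr (2 * \<theta>)) \<le> sqrt ((d k)\<^sup>2)"
        using error[of k] by (simp add: d_def t_def del: real_sqrt_abs)
      moreover have "t powr (2 * \<theta>) = (t powr \<theta>)\<^sup>2"
        using t by (simp add: powr_power mult.commute)
      ultimately have 2: "sqrt c * t powr \<theta> \<le> d k" using d0[of k] by (simp add: real_sqrt_mult)
      have "sqrt c * (p * (c * (d (Suc k))\<^sup>2)) \<le> sqrt c * (t powr \<theta> * D)"
        using 1 c by (intro mult_left_mono) auto
      also have "\<dots> \<le> d k * D" using mult_right_mono[OF 2 D0] by (simp add: mult.assoc)
      finally have "(d (Suc k))\<^sup>2 \<le> d k * (E * D)"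
        using c p by (simp add: E_def field_simps)
      \<comment> \<open>The arithmetic-geometric mean inequality turns the product into a sum, which
        is what telescopes.\<close>
      moreover have "4 * (d k * (E * D)) \<le> (d k + E * D)\<^sup>2"
        using zero_le_power2[of "d k - E * D"] by (simp add: power2_eq_square algebra_simps)
      ultimately show ?thesis by (simp add: power_mult_distrib)
    qed
    then have "2 * d (Suc k) \<le> d k + E * D"
      using d0[of k] E D0 by (meson add_nonneg_nonneg less_imp_le mult_nonneg_nonneg power2_le_imp_le)
    then show ?thesis by (simp add: V_def D_def algebra_simps)
  qed
  obtain x where x: "(\<lambda>k. b (Suc k)) \<longlonglongrightarrow> x" "\<And>k. norm (b (Suc k) - x) \<le> V k"
    using telescope_dominated_limit[of "\<lambda>k. b (Suc k)" V] step d0 E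
    by (auto simp: d_def V_def)
  \<comment> \<open>The first summand handles \<open>d k\<close>, which is at most
    \<open>sqrt (s k / c)\<close>; the second handles the desingularized value in
    \<open>V k\<close>.\<close>
  define C where "C = s 0 powr (1/2 - p) / sqrt c + E"
  have "V k \<le> C * s k powr p" for k
  proof -
    have "c * (d k)\<^sup>2 \<le> s k" using descent[of k] s0[of "Suc k"] by (simp add: d_def)
    then have "(d k)\<^sup>2 \<le> s k / c" using c by (simp add: field_simps)
    then have "d k \<le> sqrt (s k / c)" by (rule real_le_rsqrt)
    also have "\<dots> \<le> s 0 powr (1/2 - p) * s k powr p / sqrt c"
      using sqrt_le_powr_half_split[OF s0 decn p(2), of k] c
      by (simp add: real_sqrt_divide divide_right_mono)
    finally have "d k \<le> s 0 powr (1/2 - p) / sqrt c * s k powr p" by simp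
    moreover have "E * s (Suc k) powr p \<le> E * s k powr p"
      using p E s0[of "Suc k"] dec[of k] by (intro mult_left_mono powr_mono2) auto
    ultimately show ?thesis by (simp add: V_def C_def algebra_simps)
  qed
  then have "norm (b (Suc k) - x) \<le> C * s k powr (1 - \<theta>)" for k
    using x(2)[of k] unfolding p_def by (meson order_trans)
  moreover have "0 < C" using E c by (simp add: C_def add_nonneg_pos)
  ultimately show ?thesis using x(1) filterlim_sequentially_Suc by blast
qed

section \<open>Decay rates of scalar recursions and their transfer to vector sequences\<close>

text \<open>The powers \<open>y k = s k powr p\<close> satisfy
  \<open>y (Suc k) * (1 + c1 * y (Suc k)) \<le> y k\<close>, a discrete form of
  \<open>y' = - c1 * y^2\<close>, and so decay like \<open>1 / k\<close>. The bound is kept in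
  product form so that it also covers \<open>k = 0\<close>.\<close>

lemma sublinear_recursion_bound:
  fixes s :: "nat \<Rightarrow> real"
  assumes p: "0 < p" "p \<le> 1" and \<kappa>: "0 < \<kappa>" and s0: "\<And>k. 0 \<le> s k"
    and rec: "\<And>k. \<kappa> * s (Suc k) powr (1 + p) \<le> s k - s (Suc k)"
  shows "\<exists>c>0. \<forall>k. c * real k * s k powr p \<le> 1"
proof -
  define y where "y k = s k powr p" for k
  have y0: "0 \<le> y k" for k by (simp add: y_def)
  have dec: "s (Suc k) \<le> s k" for k
    using rec[of k] \<kappa> by (smt (verit) mult_nonneg_nonneg powr_ge_zero)
  have ydec: "y (Suc k) \<le> y k" for k
    unfolding y_def using dec s0 p by (intro powr_mono2) auto
  have ydecn: "y k \<le> y 0" for k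
    by (induction k) (use ydec order_trans in auto)
  \<comment> \<open>The derivative of \<open>(1 + \<kappa> * z) powr p\<close> at
    \<open>z = y 0\<close>. As \<open>p \<le> 1\<close>, it is the least slope on the range of
    \<open>y\<close>, so one constant serves every step.\<close>
  define c1 where "c1 = \<kappa> * p * (1 + \<kappa> * y 0) powr (p - 1)"
  have pos: "0 < 1 + \<kappa> * y 0" using \<kappa> y0[of 0] by (simp add: add_pos_nonneg)
  then have c1: "0 < c1" using \<kappa> p by (simp add: c1_def)
  have yrec: "y (Suc k) * (1 + c1 * y (Suc k)) \<le> y k" for k
  proof -
    define z where "z = y (Suc k)"
    have z: "0 \<le> z" "z \<le> y 0" using y0 ydecn by (auto simp: z_def)
    have "s (Suc k) powr (1 + p) = s (Suc k) * z"
      using s0[of "Suc k"] by (simp add: powr_add z_def y_def)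
    then have "s (Suc k) * (1 + \<kappa> * z) \<le> s k" using rec[of k] by (simp add: algebra_simps)
    then have "(s (Suc k) * (1 + \<kappa> * z)) powr p \<le> y k"
      unfolding y_def using s0[of "Suc k"] p \<kappa> z by (intro powr_mono2) auto
    then have 1: "z * (1 + \<kappa> * z) powr p \<le> y k"
      using s0[of "Suc k"] \<kappa> z by (simp add: powr_mult z_def y_def)
    have "(1 + \<kappa> * y 0) powr (p - 1) \<le> (1 + \<kappa> * z) powr (p - 1)"
      using p \<kappa> z by (intro powr_mono2') (auto intro: add_pos_nonneg)
    then have "c1 * z \<le> p * (1 + \<kappa> * z) powr (p - 1) * ((1 + \<kappa> * z) - 1)"
      using p \<kappa> z unfolding c1_def by (simp add: mult_left_mono mult_right_mono)
    also have "\<dots> \<le> (1 + \<kappa> * z) powr p - 1 powr p"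
      using p \<kappa> z by (intro powr_concave_tangent) (auto intro: add_pos_nonneg)
    finally have "z * (1 + c1 * z) \<le> z * (1 + \<kappa> * z) powr p"
      using z by (intro mult_left_mono) auto
    with 1 show ?thesis by (simp add: z_def)
  qed
  \<comment> \<open>Solves \<open>c * (1 + c1 * y 0) = c1\<close>, the equation that closes the
    induction: a violation at \<open>Suc k\<close> would give \<open>c1 < c * (1 + c1 * z)\<close>
    for some \<open>z \<le> y 0\<close>.\<close>
  define c where "c = c1 / (1 + c1 * y 0)"
  have pos': "0 < 1 + c1 * y 0" using c1 y0[of 0] by (simp add: add_pos_nonneg)
  then have c: "0 < c" "c1 = c * (1 + c1 * y 0)" using c1 by (auto simp: c_def)
  have "c * real k * y k \<le> 1" for k
  proof (induction k)
    case (Suc k)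
    define z where "z = y (Suc k)"
    have z: "0 \<le> z" "z \<le> y 0" using y0 ydecn by (auto simp: z_def)
    show ?case
    proof (rule ccontr)
      assume "\<not> ?thesis"
      then have *: "1 - c * z < c * real k * z" by (simp add: z_def algebra_simps)
      have "(1 - c * z) * (1 + c1 * z) < c * real k * z * (1 + c1 * z)"
        using * c1 z by (intro mult_strict_right_mono) (auto intro: add_pos_nonneg)
      also have "\<dots> \<le> c * real k * y k"
        using mult_left_mono[OF yrec[of k], of "c * real k"] c by (simp add: z_def mult.assoc)
      also have "\<dots> \<le> 1" by (rule Suc)
      finally have "z * c1 < z * (c * (1 + c1 * z))" by (simp add: algebra_simps)
      moreover have "c * (1 + c1 * z) \<le> c1"
        using c c1 z mult_left_mono[of "1 + c1 * z" "1 + c1 * y 0" c] by simp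
      ultimately show False using z by (smt (verit) mult_left_mono)
    qed
  qed simp
  with c show ?thesis unfolding y_def by blast
qed

lemma geometric_recursion_bound:
  fixes s :: "nat \<Rightarrow> real"
  assumes "0 < \<kappa>" "\<And>k. \<kappa> * s (Suc k) \<le> s k - s (Suc k)"
  shows "s k \<le> s 0 * (1 / (1 + \<kappa>)) ^ k"
proof (induction k)
  case (Suc k)
  have "(1 + \<kappa>) * s (Suc k) \<le> s k" using assms(2)[of k] by (simp add: algebra_simps)
  then have "s (Suc k) \<le> s k * (1 / (1 + \<kappa>))" using assms(1) by (simp add: field_simps)
  also have "\<dots> \<le> s 0 * (1 / (1 + \<kappa>)) ^ k * (1 / (1 + \<kappa>))"
    using assms(1) by (intro mult_right_mono Suc) auto
  finally show ?case by (simp add: mult.assoc mult.commute)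
qed simp

text \<open>The shift by \<open>m\<close> costs the factor \<open>1 / q ^ m\<close>, and the
  finitely many initial terms are absorbed into the constant.\<close>

lemma R_linear_if_shifted_bound:
  assumes q: "0 < q" "q < 1" and bound: "\<And>k. norm (u (k + m) - x) \<le> C * q ^ k"
  shows "R_linear u x"
proof -
  \<comment> \<open>Dominates each initial error and also \<open>C\<close>; the summand 1 makes it
    positive.\<close>
  define M where "M = (\<Sum>j<m. norm (u j - x)) + \<bar>C\<bar> + 1"
  have M: "0 < M" by (simp add: M_def sum_nonneg add_nonneg_pos)
  have "norm (u k - x) \<le> M / q ^ m * q ^ k" for k
  proof (cases "k < m")
    case True
    have "norm (u k - x) \<le> (\<Sum>j<m. norm (u j - x))"
      using True by (intro member_le_sum) auto
    also have "\<dots> \<le> M" by (simp add: M_def)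
    also have "M \<le> M * (q ^ k / q ^ m)"
      using M q True power_decreasing[of k m q] by (intro mult_le_cancel_left1[THEN iffD2]) auto
    finally show ?thesis by simp
  next
    case False
    have "norm (u k - x) \<le> C * q ^ (k - m)" using bound[of "k - m"] False by simp
    also have "\<dots> \<le> M * q ^ (k - m)"
    proof (rule mult_right_mono)
      have "0 \<le> (\<Sum>j<m. norm (u j - x))" by (simp add: sum_nonneg)
      then show "C \<le> M" unfolding M_def by linarith
    qed (use q in auto)
    also have "q ^ (k - m) = q ^ k / q ^ m" using False q by (simp add: power_diff)
    finally show ?thesis by simp
  qed
  then show ?thesis unfolding R_linear_def using M q by (meson divide_pos_pos zero_less_power)
qed

text \<open>The third bound makes \<open>y\<close> decay like \<open>1 / k\<close>. For
  \<open>k > 2 * m\<close> one has \<open>k \<le> 2 * (k - m)\<close>, so the index shift costs only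
  a factor 2 inside the power.\<close>

lemma bigo_powr_if_shifted_bound:
  fixes e :: "nat \<Rightarrow> real"
  assumes e0: "\<And>k. 0 \<le> e k" and \<rho>: "0 < \<rho>" and c: "0 < c"
    and C: "0 < C"
    and bound: "\<And>k. e (k + m) \<le> C * y k powr \<rho>" "\<And>k. 0 \<le> y k" "\<And>k. c * real k * y k \<le> 1"
  shows "e \<in> O(\<lambda>k. real k powr (- \<rho>))"
proof (rule bigoI)
  show "\<forall>\<^sub>F k in sequentially. norm (e k) \<le> C * (2 / c) powr \<rho> * norm (real k powr (- \<rho>))"
  proof (rule eventually_sequentiallyI)
    fix k assume k: "2 * m + 1 \<le> k"
    define j where "j = k - m"
    have j: "k = j + m" "real k \<le> 2 * real j" "0 < j" using k by (auto simp: j_def)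
    have kpos: "0 < real k" using k by simp
    have "c * real k * y j \<le> c * (2 * real j) * y j"
      using j c bound(2) by (intro mult_right_mono mult_left_mono) auto
    also have "\<dots> \<le> 2" using bound(3)[of j] by simp
    finally have "y j \<le> 2 / c * (1 / real k)" using c kpos by (simp add: field_simps)
    then have "y j powr \<rho> \<le> (2 / c * (1 / real k)) powr \<rho>"
      using bound(2) \<rho> by (intro powr_mono2) auto
    also have "\<dots> = (2 / c) powr \<rho> * real k powr (- \<rho>)"
      using c kpos by (simp add: powr_mult powr_divide powr_minus_divide)
    finally have "C * y j powr \<rho> \<le> C * ((2 / c) powr \<rho> * real k powr (- \<rho>))"
      using C by (intro mult_left_mono) auto
    then show "norm (e k) \<le> C * (2 / c) powr \<rho> * norm (real k powr (- \<rho>))"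
      using e0[of k] bound(1)[of j] j(1) by (simp add: mult.assoc)
  qed
qed

text \<open>With \<open>p = 2 * \<theta> - 1\<close>, the bound \<open>s powr (1 - \<theta>)\<close>
  is the power \<open>(1 - \<theta>) / p\<close> of \<open>s powr p\<close>, which decays like
  \<open>1 / k\<close>. For \<open>\<theta> = 1 / 2\<close> the recursion is linear and the error is
  of order \<open>sqrt s\<close>, whence the ratio \<open>sqrt q\<close>. The general
  \<open>u\<close> and \<open>m\<close> allow the use for both \<open>a\<close> and
  \<open>b\<close>.\<close>

lemma rates_of_desingularized_error:
  fixes u :: "nat \<Rightarrow> 'a::real_normed_vector" and s :: "nat \<Rightarrow> real"
  assumes \<theta>: "1 / 2 \<le> \<theta>" "\<theta> < 1" and \<kappa>: "0 < \<kappa>" and s0: "\<And>k. 0 \<le> s k"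
    and rec: "\<And>k. \<kappa> * s (Suc k) powr (2 * \<theta>) \<le> s k - s (Suc k)"
    and C: "0 < C" and bound: "\<And>k. norm (u (k + m) - x) \<le> C * s k powr (1 - \<theta>)"
  shows "1 / 2 < \<theta> \<Longrightarrow>
      (\<lambda>k. norm (u k - x)) \<in> O(\<lambda>k. real k powr (- ((1 - \<theta>) / (2 * \<theta> - 1))))"
    and "\<theta> = 1 / 2 \<Longrightarrow> R_linear u x"
proof -
  assume \<theta>': "1 / 2 < \<theta>"
  define p where "p = 2 * \<theta> - 1"
  have p: "0 < p" "p \<le> 1" "2 * \<theta> = 1 + p" using \<theta>' \<theta> by (auto simp: p_def)
  obtain c where c: "0 < c" "\<And>k. c * real k * s k powr p \<le> 1"
    using sublinear_recursion_bound[where s = s, OF p(1,2) \<kappa> s0 rec[unfolded p(3)]] by blast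
  show "(\<lambda>k. norm (u k - x)) \<in> O(\<lambda>k. real k powr (- ((1 - \<theta>) / (2 * \<theta> - 1))))"
  proof (rule bigo_powr_if_shifted_bound[where y = "\<lambda>k. s k powr p" and C = C and m = m])
    show "norm (u (k + m) - x) \<le> C * (s k powr p) powr ((1 - \<theta>) / (2 * \<theta> - 1))" for k
      using bound[of k] p(1) by (simp add: powr_powr flip: p_def)
  qed (use c C \<theta>' \<theta> in auto)
next
  assume half: "\<theta> = 1 / 2"
  define q where "q = 1 / (1 + \<kappa>)"
  have q: "0 < q" "q < 1" using \<kappa> by (auto simp: q_def)
  have geo: "s k \<le> s 0 * q ^ k" for k
    using geometric_recursion_bound[of \<kappa> s k] \<kappa> rec s0 half by (simp add: q_def)
  show "R_linear u x"
  proof (rule R_linear_if_shifted_bound[where q = "sqrt q" and m = m and C = "C * sqrt (s 0)"])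
    fix k
    have "norm (u (k + m) - x) \<le> C * sqrt (s k)"
      using bound[of k] s0[of k] half by (simp add: powr_half_sqrt)
    also have "\<dots> \<le> C * sqrt (s 0 * q ^ k)"
      using geo[of k] C by (intro mult_left_mono real_sqrt_le_mono) auto
    finally show "norm (u (k + m) - x) \<le> C * sqrt (s 0) * sqrt q ^ k"
      by (simp add: real_sqrt_mult real_sqrt_power mult.assoc)
  qed (use q in auto)
qed

subsection \<open>Bregman distances on compact sets\<close>

text \<open>The first-order Taylor remainder of \<open>g\<close>: a real-valued counterpart of
  \<open>bregman\<close> that avoids extended arithmetic.\<close>

definition bregman_remainder :: "('a::real_inner \<Rightarrow> real) \<Rightarrow> 'a \<Rightarrow> 'a \<Rightarrow> real" where
  "bregman_remainder g x y = g x - g y - gradient g y \<bullet> (x - y)"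

lemma bregman_eq_remainder:
  assumes "convex_ereal_fun f" "x \<in> edom f" "y \<in> interior (edom f)"
  shows "bregman f x y = ereal (bregman_remainder (finite_part f) x y)"
proof -
  have "f z = ereal (finite_part f z)" if "z \<in> edom f" for z
    using that assms(1) unfolding edom_def convex_ereal_fun_def finite_part_def
    by (auto simp: ereal_real)
  moreover have "y \<in> edom f" using assms(3) interior_subset by blast
  ultimately show ?thesis
    using assms by (simp add: bregman_def bregman_remainder_def)
qed

lemma C2_posdef_on_gradient:
  assumes "C2_posdef_on G g" "x \<in> G"
  shows "(g has_derivative (\<lambda>h. h \<bullet> gradient g x)) (at x)" "isCont (gradient g) x"
proof -
  obtain v where "GDERIV g x :> v" using assms unfolding C2_posdef_on_def by blast
  then show "(g has_derivative (\<lambda>h. h \<bullet> gradient g x)) (at x)"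
    using gradient_eqI unfolding gderiv_def by metis
  show "isCont (gradient g) x"
    using assms has_derivative_continuous unfolding C2_posdef_on_def by blast
qed

lemma tendsto_bregman_remainder:
  assumes "C2_posdef_on G g" "x \<in> G" "y \<in> G" "(u \<longlongrightarrow> x) F" "(v \<longlongrightarrow> y) F"
  shows "((\<lambda>n. bregman_remainder g (u n) (v n)) \<longlongrightarrow> bregman_remainder g x y) F"
proof -
  have "isCont g x" "isCont g y" "isCont (gradient g) y"
    using assms C2_posdef_on_gradient has_derivative_continuous by blast+
  then show ?thesis unfolding bregman_remainder_def
    by (intro tendsto_intros isCont_tendsto_compose[of _ g] isCont_tendsto_compose[of _ "gradient g"]
        assms) auto
qed

text \<open>Taylor's formula with Lagrange remainder, applied to the restriction of \<open>g\<close>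
  to the segment from \<open>y\<close> to \<open>x\<close>.\<close>

lemma bregman_remainder_second_order:
  assumes grad: "\<And>z. z \<in> S \<Longrightarrow> (g has_derivative (\<lambda>h. h \<bullet> gradient g z)) (at z)"
    and hess: "\<And>z. z \<in> S \<Longrightarrow> (gradient g has_derivative blinfun_apply (H z)) (at z)"
    and S: "convex S" "x \<in> S" "y \<in> S"
  shows "\<exists>z\<in>S. bregman_remainder g x y = (x - y) \<bullet> H z (x - y) / 2"
proof -
  define v where "v = x - y"
  define p where "p t = y + t *\<^sub>R v" for t :: real
  have pS: "p t \<in> S" if "0 \<le> t" "t \<le> 1" for t
  proof -
    have "p t = (1 - t) *\<^sub>R y + t *\<^sub>R x" by (simp add: p_def v_def algebra_simps)
    then show ?thesis using convexD_alt[OF S(1,3,2) that] by simp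
  qed
  have p': "(p has_derivative (\<lambda>h. h *\<^sub>R v)) (at t)" for t
    unfolding p_def by (auto intro!: derivative_eq_intros)
  have d0: "DERIV (\<lambda>t. g (p t)) t :> v \<bullet> gradient g (p t)" if "0 \<le> t" "t \<le> 1" for t
    using has_derivative_compose[OF p' grad[OF pS[OF that]]]
    by (simp add: has_field_derivative_def mult_commute_abs inner_commute)
  have d1: "DERIV (\<lambda>t. v \<bullet> gradient g (p t)) t :> v \<bullet> H (p t) v" if "0 \<le> t" "t \<le> 1" for t
    using has_derivative_inner_right[OF has_derivative_compose[OF p' hess[OF pS[OF that]]], of v]
    by (simp add: has_field_derivative_def blinfun.scaleR_right mult_commute_abs)
  \<comment> \<open>The derivatives of orders 0, 1 and 2 along the segment, arranged as the indexed
    family that \<open>Maclaurin\<close> expects.\<close>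
  define diff where "diff = (\<lambda>m::nat. if m = 0 then (\<lambda>t. g (p t))
    else if m = 1 then (\<lambda>t. v \<bullet> gradient g (p t)) else (\<lambda>t. v \<bullet> H (p t) v))"
  have "\<exists>t::real. 0 < t \<and> t < 1 \<and> g (p 1) = (\<Sum>m<2. (diff m 0 / fact m) * 1 ^ m)
      + (diff 2 t / fact 2) * 1 ^ 2"
    by (rule Maclaurin) (use d0 d1 in \<open>auto simp: diff_def less_2_cases_iff\<close>)
  then obtain t where t: "0 < t" "t < 1"
    "g (p 1) = g (p 0) + v \<bullet> gradient g (p 0) + v \<bullet> H (p t) v / 2"
    by (auto simp: diff_def numeral_2_eq_2)
  then have "bregman_remainder g x y = (x - y) \<bullet> H (p t) (x - y) / 2"
    by (simp add: p_def v_def bregman_remainder_def inner_commute)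
  then show ?thesis using pS t by force
qed

text \<open>The Hessian form attains its extrema on the compact product of \<open>S\<close> and the
  unit sphere, and the minimum is positive by definiteness. Homogeneity and the second-order formula
  give the bounds, with half of these extrema as constants.\<close>

lemma bregman_remainder_quadratic_bounds:
  fixes S :: "'a::euclidean_space set"
  assumes C2: "C2_posdef_on G g" and S: "compact S" "convex S" "S \<noteq> {}" "S \<subseteq> G"
  shows "\<exists>m M. 0 < m \<and> 0 < M \<and> (\<forall>x\<in>S. \<forall>y\<in>S.
    m * (norm (x - y))\<^sup>2 \<le> bregman_remainder g x y \<and>
    bregman_remainder g x y \<le> M * (norm (x - y))\<^sup>2)"
proof -
  obtain H :: "'a \<Rightarrow> ('a \<Rightarrow>\<^sub>L 'a)" where H: "continuous_on G H"
    "\<And>x. x \<in> G \<Longrightarrow> (gradient g has_derivative blinfun_apply (H x)) (at x)"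
    "\<And>x h. x \<in> G \<Longrightarrow> h \<noteq> 0 \<Longrightarrow> 0 < h \<bullet> H x h"
    using C2 unfolding C2_posdef_on_def by blast
  let ?T = "S \<times> sphere (0::'a) 1"
  let ?q = "\<lambda>(z, h). h \<bullet> H z h"
  obtain e :: 'a where e: "e \<in> sphere 0 1" by (metis SOME_Basis norm_Basis mem_sphere_0)
  have T: "compact ?T" "?T \<noteq> {}" using S e by (auto intro: compact_Times)
  have "continuous_on ?T (\<lambda>w. H (fst w))"
    by (rule continuous_on_compose2[OF H(1)]) (use S in \<open>auto intro!: continuous_intros\<close>)
  then have cont: "continuous_on ?T ?q"
    unfolding case_prod_beta by (intro continuous_intros)
  obtain w where w: "w \<in> ?T" "\<And>u. u \<in> ?T \<Longrightarrow> ?q w \<le> ?q u"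
    using continuous_attains_inf[OF T cont] by blast
  obtain w' where w': "w' \<in> ?T" "\<And>u. u \<in> ?T \<Longrightarrow> ?q u \<le> ?q w'"
    using continuous_attains_sup[OF T cont] by blast
  have pos: "0 < ?q w" using w(1) H(3)[of "fst w" "snd w"] S(4) by (cases w; cases "snd w = 0") auto
  then have pos': "0 < ?q w'" using w(2)[OF w'(1)] by linarith
  have "?q w / 2 * (norm (x - y))\<^sup>2 \<le> bregman_remainder g x y \<and>
      bregman_remainder g x y \<le> ?q w' / 2 * (norm (x - y))\<^sup>2" if xy: "x \<in> S" "y \<in> S" for x y
  proof -
    obtain z where z: "z \<in> S" "bregman_remainder g x y = (x - y) \<bullet> H z (x - y) / 2"
      using bregman_remainder_second_order[of S g H x y] C2_posdef_on_gradient(1)[OF C2] H(2) S xy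
      by blast
    define n where "n = norm (x - y)"
    have *: "?q w * n\<^sup>2 \<le> (x - y) \<bullet> H z (x - y) \<and> (x - y) \<bullet> H z (x - y) \<le> ?q w' * n\<^sup>2"
    proof (cases "x = y")
      case False
      then have n: "0 < n" by (simp add: n_def)
      define h where "h = (1 / n) *\<^sub>R (x - y)"
      have h: "(z, h) \<in> ?T" "x - y = n *\<^sub>R h" using z n by (auto simp: h_def n_def)
      have "(x - y) \<bullet> H z (x - y) = ?q (z, h) * n\<^sup>2"
        by (simp add: h(2) blinfun.scaleR_right power2_eq_square)
      then show ?thesis using w(2)[OF h(1)] w'(2)[OF h(1)] by (auto intro: mult_right_mono)
    qed (simp add: n_def)
    then show ?thesis by (simp add: z(2) n_def)
  qed
  then show ?thesis using pos pos' by (intro exI[of _ "?q w / 2"] exI[of _ "?q w' / 2"]) auto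
qed

section \<open>The cosine estimate and uniform constants on compact sets\<close>

text \<open>The law of cosines at the vertex \<open>z\<close>: replacing the sum of squared sides by
  twice their product leaves \<open>2 * norm u * norm v * (1 - cos)\<close>, and that product of
  sides is at least \<open>q\<close>.\<close>

lemma dist_sq_ge_angle:
  fixes x y z :: "'a::real_inner"
  assumes "0 \<le> q" "q \<le> (norm (x - z))\<^sup>2" "q \<le> (norm (y - z))\<^sup>2"
  shows "2 * q * (1 - cos (vec_angle (x - z) (y - z))) \<le> (norm (x - y))\<^sup>2"
proof -
  define u where "u = x - z"
  define v where "v = y - z"
  let ?c = "(u \<bullet> v) / (norm u * norm v)"
  have "\<bar>?c\<bar> \<le> 1"
    using Cauchy_Schwarz_ineq2[of u v] by (auto simp: abs_mult divide_le_eq_1)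
  then have cos: "cos (vec_angle u v) = ?c" by (simp add: vec_angle_def cos_arccos_abs)
  have "(sqrt q)\<^sup>2 \<le> norm u * norm v"
    unfolding power2_eq_square using assms
    by (intro mult_mono) (auto simp: u_def v_def intro: real_le_lsqrt)
  then have "q \<le> norm u * norm v" using assms(1) by simp
  then have "2 * q * (1 - ?c) \<le> 2 * (norm u * norm v) * (1 - ?c)"
    using abs_le_D1[OF \<open>\<bar>?c\<bar> \<le> 1\<close>] by (intro mult_right_mono) (simp_all del: divide_le_eq_1)
  \<comment> \<open>If a side vanishes, the quotient \<open>?c\<close> is 0 by division by zero and
    both sides are 0.\<close>
  also have "\<dots> = 2 * (norm u * norm v) - 2 * (u \<bullet> v)"
    by (cases "u = 0 \<or> v = 0") (auto simp: field_simps)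
  also have "\<dots> \<le> (norm u)\<^sup>2 + (norm v)\<^sup>2 - 2 * (u \<bullet> v)"
    using sum_squares_bound[of "norm u" "norm v"] by simp
  also have "\<dots> = (norm (u - v))\<^sup>2" by (simp add: power2_norm_eq_inner inner_diff inner_commute)
  also have "u - v = x - y" by (simp add: u_def v_def)
  finally show ?thesis using cos by (simp add: u_def v_def)
qed

text \<open>If no constant works eventually, the constants \<open>1 / Suc n\<close> fail along a
  subsequence. It has a cluster point in \<open>S\<close>, whose local constant eventually exceeds
  the failing ones, contradicting \<open>anti\<close>.\<close>

lemma compact_cluster_uniform_constant:
  fixes z :: "nat \<Rightarrow> 'm::metric_space" and Q :: "real \<Rightarrow> nat \<Rightarrow> bool"
  assumes S: "compact S" "\<And>k. z k \<in> S"
    and anti: "\<And>c c' k. Q c k \<Longrightarrow> c' \<le> c \<Longrightarrow> Q c' k"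
    and local: "\<And>x \<kappa>. strict_mono \<kappa> \<Longrightarrow> (z \<circ> \<kappa>) \<longlonglongrightarrow> x \<Longrightarrow>
      \<exists>c W. 0 < c \<and> open W \<and> x \<in> W \<and> (\<forall>\<^sub>F k in sequentially. z k \<in> W \<longrightarrow> Q c k)"
  shows "\<exists>c>0. \<forall>\<^sub>F k in sequentially. Q c k"
proof (rule ccontr)
  assume "\<not> ?thesis"
  then have bad: "\<exists>k\<ge>N. \<not> Q (1 / real (Suc n)) k" for n N
    unfolding eventually_sequentially by (meson divide_pos_pos of_nat_0_less_iff zero_less_Suc zero_less_one)
  have "\<exists>\<kappa>. \<forall>n. \<not> Q (1 / real (Suc n)) (\<kappa> n) \<and> \<kappa> n < \<kappa> (Suc n)"
  proof (rule dependent_nat_choice)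
    show "\<exists>x. \<not> Q (1 / real (Suc 0)) x" using bad by blast
    show "\<exists>y. \<not> Q (1 / real (Suc (Suc n))) y \<and> x < y" for x n
      using bad[of "Suc x" "Suc n"] by (auto simp: Suc_le_eq)
  qed
  then obtain \<kappa> where \<kappa>: "\<And>n. \<not> Q (1 / real (Suc n)) (\<kappa> n)" "strict_mono \<kappa>"
    by (auto simp: strict_mono_Suc_iff)
  obtain x r where x: "strict_mono r" "((z \<circ> \<kappa>) \<circ> r) \<longlonglongrightarrow> x"
    using S unfolding compact_def by (metis comp_apply)
  have sm: "strict_mono (\<kappa> \<circ> r)" using \<kappa>(2) x(1) by (rule strict_mono_o)
  obtain c W where c: "0 < c" "open W" "x \<in> W" "\<forall>\<^sub>F k in sequentially. z k \<in> W \<longrightarrow> Q c k"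
    using local[OF sm x(2)[unfolded comp_assoc]] by blast
  have "\<forall>\<^sub>F n in sequentially. z (\<kappa> (r n)) \<in> W"
    using topological_tendstoD[OF x(2) c(2,3)] by simp
  moreover have "\<forall>\<^sub>F n in sequentially. z (\<kappa> (r n)) \<in> W \<longrightarrow> Q c (\<kappa> (r n))"
    using eventually_subseq[OF sm c(4)] by simp
  moreover have "\<forall>\<^sub>F n in sequentially. 1 / real (Suc n) < c"
    using order_tendstoD(2)[OF LIMSEQ_inverse_real_of_nat c(1)] by (simp add: inverse_eq_divide)
  ultimately have "\<forall>\<^sub>F n in sequentially. False"
  proof eventually_elim
    case (elim n)
    have "1 / real (Suc (r n)) \<le> 1 / real (Suc n)"
      using seq_suble[OF x(1), of n] by (simp add: frac_le)
    then show ?case using elim \<kappa>(1)[of "r n"] anti by fastforce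
  qed
  then show False by simp
qed

subsection \<open>Alternating Bregman projections\<close>

locale bregman_alternation =
  fixes f :: "'a::euclidean_space \<Rightarrow> ereal" and A B :: "'a set" and a b :: "nat \<Rightarrow> 'a"
  assumes legendre: "convex_legendre f"
    and C2: "C2_posdef_on (interior (edom f)) (finite_part f)"
    and A: "A \<subseteq> interior (edom f)" "compact A" "A \<noteq> {}"
    and B: "B \<subseteq> interior (edom f)" "compact B"
    and alt: "alternating_sequence f A B a b"
begin

abbreviation D :: "'a \<Rightarrow> 'a \<Rightarrow> real" where
  "D \<equiv> bregman_remainder (finite_part f)"

text \<open>Both sets lie in the interior of the domain, so all distances between their points are
  finite and the argument can stay in the reals.\<close>

lemma bregman_eq_D:
  assumes "x \<in> A \<union> B" "y \<in> A \<union> B"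
  shows "bregman f x y = ereal (D x y)"
  using assms A B legendre interior_subset
  by (intro bregman_eq_remainder) (auto simp: convex_legendre_def)

lemma tendsto_D:
  assumes "x \<in> A \<union> B" "y \<in> A \<union> B" "(u \<longlongrightarrow> x) F" "(v \<longlongrightarrow> y) F"
  shows "((\<lambda>n. D (u n) (v n)) \<longlongrightarrow> D x y) F"
  using assms A B by (intro tendsto_bregman_remainder[OF C2]) auto

lemma left_proj_iff:
  assumes "x \<in> A"
  shows "y \<in> left_proj f B x \<longleftrightarrow> y \<in> B \<and> (\<forall>z\<in>B. D y x \<le> D z x)"
  using assms by (auto simp: left_proj_def is_arg_min_def bregman_eq_D not_less)

lemma right_proj_iff:
  assumes "y \<in> B"
  shows "x \<in> right_proj f A y \<longleftrightarrow> x \<in> A \<and> (\<forall>z\<in>A. D y x \<le> D y z)"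
  using assms by (auto simp: right_proj_def is_arg_min_def bregman_eq_D not_less)

lemma left_dist_eq:
  assumes "x \<in> A" "y \<in> left_proj f B x"
  shows "left_dist f B x = ereal (D y x)"
proof -
  have "y \<in> B" "\<And>z. z \<in> B \<Longrightarrow> D y x \<le> D z x" using assms left_proj_iff by auto
  then show ?thesis unfolding left_dist_def using assms(1)
    by (intro antisym INF_lower2[of y] INF_greatest) (auto simp: bregman_eq_D)
qed

text \<open>Taylor's formula needs the segments between the points. The convex hull of
  \<open>A \<union> B\<close> contains them, is compact, and stays in the interior of the domain
  because that interior is convex.\<close>

lemma D_quadratic_bounds:
  "\<exists>m M. 0 < m \<and> 0 < M \<and> (\<forall>x \<in> A \<union> B. \<forall>y \<in> A \<union> B.
     m * (norm (x - y))\<^sup>2 \<le> D x y \<and> D x y \<le> M * (norm (x - y))\<^sup>2)"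
proof -
  have "convex (interior (edom f))"
    using legendre
    by (simp add: convex_legendre_def legendre_type_def strictly_convex_on_def)
  then have "convex hull (A \<union> B) \<subseteq> interior (edom f)"
    using A B by (intro hull_minimal) auto
  moreover have "compact (convex hull (A \<union> B))"
    using A B by (intro compact_convex_hull compact_Un)
  moreover have "convex hull (A \<union> B) \<noteq> {}" using A by simp
  moreover have "A \<union> B \<subseteq> convex hull (A \<union> B)" by (rule hull_subset)
  ultimately show ?thesis
    using bregman_remainder_quadratic_bounds[OF C2, of "convex hull (A \<union> B)"]
    by (meson convex_convex_hull subsetD)
qed

lemma seq_mem: "a k \<in> A" "b k \<in> B"
  using alt by (auto simp: alternating_sequence_def)

lemma seq_proj: "b k \<in> left_proj f B (a k)" "a (Suc k) \<in> right_proj f A (b k)"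
  using alt by (auto simp: alternating_sequence_def)

lemma seq_min:
  "x \<in> B \<Longrightarrow> D (b k) (a k) \<le> D x (a k)"
  "x \<in> A \<Longrightarrow> D (b k) (a (Suc k)) \<le> D (b k) x"
  using seq_proj[of k] seq_mem left_proj_iff right_proj_iff by auto

lemma seq_block: "rl_block f A B (b k) (a (Suc k)) (b (Suc k))"
  using seq_proj seq_mem by (simp add: rl_block_def)

lemma D_Suc_le: "D (b (Suc k)) (a (Suc k)) \<le> D (b k) (a k)"
  using seq_min(1)[of "b k" "Suc k"] seq_min(2)[of "a k" k] seq_mem order_trans by blast

lemma D_limit:
  assumes "is_gap f A B a b K r"
  shows "(\<lambda>k. D (b k) (a k)) \<longlonglongrightarrow> r\<^sup>2 / 2"
  using assms seq_mem by (simp add: is_gap_def bregman_eq_D)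

lemma gap_le_D:
  assumes "is_gap f A B a b K r"
  shows "r\<^sup>2 / 2 \<le> D (b k) (a k)"
  by (rule decseq_ge[OF decseq_SucI D_limit[OF assms]]) (rule D_Suc_le)

text \<open>Right optimality of the limit pair compares \<open>b k\<close> with \<open>a k\<close>, although \<open>a k\<close> was not
  projected from \<open>b k\<close>: replacing \<open>a (Suc k)\<close> by \<open>a k\<close> costs at most the decrease of the
  distance, which tends to \<open>0\<close>.\<close>

lemma cluster_pair_in_gap:
  assumes gap: "is_gap f A B a b K r" and \<kappa>: "strict_mono \<kappa>"
    and lim: "(\<lambda>n. b (Suc (\<kappa> n))) \<longlonglongrightarrow> bs" "(\<lambda>n. a (Suc (\<kappa> n))) \<longlonglongrightarrow> as"
  shows "(bs, as) \<in> K" "gap_value f bs as = r"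
proof -
  have sm: "strict_mono (Suc \<circ> \<kappa>)" using \<kappa> by (simp add: strict_mono_def)
  have mem: "bs \<in> B" "as \<in> A"
    using closed_sequentially[OF compact_imp_closed[OF B(2)] _ lim(1)]
      closed_sequentially[OF compact_imp_closed[OF A(2)] _ lim(2)] seq_mem by auto
  have Dlim: "(\<lambda>n. D (b (Suc (\<kappa> n))) (a (Suc (\<kappa> n)))) \<longlonglongrightarrow> D bs as"
    using mem lim by (intro tendsto_D) auto
  moreover have glim: "(\<lambda>n. D (b (Suc (\<kappa> n))) (a (Suc (\<kappa> n)))) \<longlonglongrightarrow> r\<^sup>2 / 2"
    using LIMSEQ_subseq_LIMSEQ[OF D_limit[OF gap] sm] by (simp add: comp_def)
  ultimately have Dr: "D bs as = r\<^sup>2 / 2" by (rule LIMSEQ_unique)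
  have "(\<lambda>n. D (b (Suc (Suc (\<kappa> n)))) (a (Suc (Suc (\<kappa> n))))) \<longlonglongrightarrow> r\<^sup>2 / 2"
    using LIMSEQ_subseq_LIMSEQ[OF LIMSEQ_Suc[OF D_limit[OF gap]] sm] by (simp add: comp_def)
  from tendsto_diff[OF glim this] have gaplim:
    "(\<lambda>n. D (b (Suc (\<kappa> n))) (a (Suc (\<kappa> n))) - D (b (Suc (Suc (\<kappa> n)))) (a (Suc (Suc (\<kappa> n))))) \<longlonglongrightarrow> 0"
    by simp
  have "D bs as \<le> D y as" if y: "y \<in> B" for y
  proof (rule LIMSEQ_le[OF Dlim])
    show "(\<lambda>n. D y (a (Suc (\<kappa> n)))) \<longlonglongrightarrow> D y as" using mem y lim by (intro tendsto_D) auto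
  qed (use seq_min y in auto)
  then have left: "bs \<in> left_proj f B as" using mem left_proj_iff by simp
  have "D bs as \<le> D bs x" if x: "x \<in> A" for x
  proof (rule LIMSEQ_le[OF Dlim])
    show "(\<lambda>n. D (b (Suc (\<kappa> n))) x + (D (b (Suc (\<kappa> n))) (a (Suc (\<kappa> n)))
        - D (b (Suc (Suc (\<kappa> n)))) (a (Suc (Suc (\<kappa> n)))))) \<longlonglongrightarrow> D bs x"
      using tendsto_add[OF tendsto_D[OF _ _ lim(1) tendsto_const[of x]] gaplim] mem x by simp
    have "D (b k) (a k) \<le> D (b k) x + (D (b k) (a k) - D (b (Suc k)) (a (Suc k)))" for k
      using seq_min(1)[of "b k" "Suc k"] seq_min(2)[OF x, of k] seq_mem[of k] by simp
    then show "\<exists>N. \<forall>n\<ge>N. D (b (Suc (\<kappa> n))) (a (Suc (\<kappa> n))) \<le> D (b (Suc (\<kappa> n))) x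
        + (D (b (Suc (\<kappa> n))) (a (Suc (\<kappa> n))) - D (b (Suc (Suc (\<kappa> n)))) (a (Suc (Suc (\<kappa> n)))))"
      by blast
  qed
  then have right: "as \<in> right_proj f A bs" using mem right_proj_iff by simp
  have "bs \<in> accumulation_points b" "as \<in> accumulation_points a"
    using lim sm by (auto simp: accumulation_points_def comp_def intro!: exI[of _ "Suc \<circ> \<kappa>"])
  then show "(bs, as) \<in> K" using gap left right mem by (simp add: is_gap_def gap_pair_def)
  \<comment> \<open>The angle condition uses the gap value of the pair itself; the common limit of
    the distances identifies it with the gap of the sequence.\<close>
  show "gap_value f bs as = r"
    using gap mem Dr by (intro gap_value_eqI) (auto simp: is_gap_def bregman_eq_D)
qed

section \<open>Descent and error bounds near a gap pair, and their uniform version\<close>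

text \<open>The block inequality starts from \<open>D (b k) (a (Suc k))\<close>, which is at most
  \<open>D (b k) (a k)\<close> by the right projection; the lower quadratic bound turns
  \<open>D (b k) (b (Suc k))\<close> into a squared step.\<close>

lemma three_point_descent:
  assumes "rl_three_point f A B bs as"
  shows "\<exists>c W. 0 < c \<and> open W \<and> (bs, as) \<in> W \<and> (\<forall>k. (b (Suc k), a (Suc k)) \<in> W \<longrightarrow>
    c * (norm (b k - b (Suc k)))\<^sup>2 \<le> D (b k) (a k) - D (b (Suc k)) (a (Suc k)))"
proof -
  obtain m where m: "0 < m" "\<And>x y. x \<in> A \<union> B \<Longrightarrow> y \<in> A \<union> B \<Longrightarrow> m * (norm (x - y))\<^sup>2 \<le> D x y"
    using D_quadratic_bounds by blast
  obtain l \<delta> where l: "0 < l" "0 < \<delta>" "\<And>b0 a' b'. rl_block f A B b0 a' b' \<Longrightarrow>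
      norm (b' - bs) < \<delta> \<Longrightarrow> norm (a' - as) < \<delta> \<Longrightarrow>
      bregman f b0 a' \<ge> bregman f b' a' + ereal l * bregman f b0 b'"
    using assms unfolding rl_three_point_def by blast
  have "l * m * (norm (b k - b (Suc k)))\<^sup>2 \<le> D (b k) (a k) - D (b (Suc k)) (a (Suc k))"
    if "(b (Suc k), a (Suc k)) \<in> ball bs \<delta> \<times> ball as \<delta>" for k
  proof -
    have "D (b (Suc k)) (a (Suc k)) + l * D (b k) (b (Suc k)) \<le> D (b k) (a (Suc k))"
      using l(3)[OF seq_block[of k]] that seq_mem
      by (simp add: bregman_eq_D dist_norm norm_minus_commute)
    moreover have "D (b k) (a (Suc k)) \<le> D (b k) (a k)" using seq_min(2) seq_mem by blast
    moreover have "l * (m * (norm (b k - b (Suc k)))\<^sup>2) \<le> l * D (b k) (b (Suc k))"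
      using m(2) seq_mem l by (intro mult_left_mono) auto
    ultimately show ?thesis by (simp add: mult.assoc)
  qed
  moreover have "open (ball bs \<delta> \<times> ball as \<delta>)" by (intro open_Times) auto
  moreover have "(bs, as) \<in> ball bs \<delta> \<times> ball as \<delta>" using l by simp
  ultimately show ?thesis using l m by (metis mult_pos_pos)
qed

text \<open>In the triangle with vertex \<open>a (Suc k)\<close>, both adjacent sides have squared
  length at least \<open>D (b (Suc k)) (a (Suc k)) / M\<close>. The cosine estimate and the angle
  condition then bound the squared step from below by a multiple of this distance times
  \<open>angle_sigma\<close>.\<close>

lemma angle_error_bound:
  assumes gap: "is_gap f A B a b K r" and val: "gap_value f bs as = r" and \<theta>: "\<theta> < 1"
    and angle: "rl_angle_condition f A B (desing_power \<theta>) bs as"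
  shows "\<exists>c W. 0 < c \<and> open W \<and> (bs, as) \<in> W \<and>
    (\<forall>\<^sub>F k in sequentially. (b (Suc k), a (Suc k)) \<in> W \<longrightarrow>
      c * (D (b (Suc k)) (a (Suc k)) - r\<^sup>2 / 2) powr (2 * \<theta>) \<le> (norm (b k - b (Suc k)))\<^sup>2)"
proof -
  obtain M where M: "0 < M" "\<And>x y. x \<in> A \<union> B \<Longrightarrow> y \<in> A \<union> B \<Longrightarrow> D x y \<le> M * (norm (x - y))\<^sup>2"
    using D_quadratic_bounds by blast
  have r: "0 \<le> r" using gap by (simp add: is_gap_def)
  obtain W \<gamma> \<eta> where W: "open W" "(bs, as) \<in> W" "0 < \<gamma>" "0 < \<eta>"
    and ang: "\<And>b0 a' b'. rl_block f A B b0 a' b' \<Longrightarrow> (b', a') \<in> W \<Longrightarrow>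
      ereal (r\<^sup>2 / 2) < bregman f b' a' \<Longrightarrow> bregman f b' a' < ereal (r\<^sup>2 / 2 + \<eta>) \<Longrightarrow>
      (1 - cos (vec_angle (b0 - a') (b' - a'))) /
        angle_sigma (desing_power \<theta>) r (real_of_ereal (left_dist f B a') - r\<^sup>2 / 2) \<ge> \<gamma>"
    using angle unfolding rl_angle_condition_def Let_def val by blast
  \<comment> \<open>Makes \<open>h * s powr (2 * \<theta>) \<le> D u v * \<sigma>\<close> true in
    both cases: for \<open>r > 0\<close> the distance is at least \<open>r\<^sup>2 / 2\<close>; for
    \<open>r = 0\<close> it equals \<open>s\<close> and cancels the extra \<open>1 / s\<close> in
    \<open>\<sigma>\<close>.\<close>
  define h where "h = (if r > 0 then r\<^sup>2 / 2 else 1)"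
  define c where "c = 2 * h / M * \<gamma>"
  have h: "0 < h" using r by (simp add: h_def)
  have ev: "\<forall>\<^sub>F k in sequentially. D (b (Suc k)) (a (Suc k)) < r\<^sup>2 / 2 + \<eta>"
    using order_tendstoD(2)[OF LIMSEQ_Suc[OF D_limit[OF gap]]] W(4) by simp
  have "\<forall>\<^sub>F k in sequentially. (b (Suc k), a (Suc k)) \<in> W \<longrightarrow>
      c * (D (b (Suc k)) (a (Suc k)) - r\<^sup>2 / 2) powr (2 * \<theta>) \<le> (norm (b k - b (Suc k)))\<^sup>2"
    using ev
  proof eventually_elim
    case (elim k)
    define u where "u = b (Suc k)"
    define v where "v = a (Suc k)"
    define s where "s = D u v - r\<^sup>2 / 2"
    have uv: "u \<in> B" "v \<in> A" using seq_mem by (auto simp: u_def v_def)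
    have s0: "0 \<le> s" using gap_le_D[OF gap, of "Suc k"] by (simp add: s_def u_def v_def)
    show ?case
    \<comment> \<open>The angle condition requires a distance strictly above the gap. At
      \<open>s = 0\<close> the claim is trivial since
      \<open>0 powr (2 * \<theta>) = 0\<close>.\<close>
    proof (cases "s = 0 \<or> (u, v) \<notin> W")
      case True
      then show ?thesis by (auto simp flip: s_def u_def v_def)
    next
      case False
      then have s: "0 < s" and inW: "(u, v) \<in> W" using s0 by auto
      define \<sigma> where "\<sigma> = angle_sigma (desing_power \<theta>) r s"
      have deriv: "(deriv (desing_power \<theta>) s)\<^sup>2 = 1 / s powr (2 * \<theta>)"
        using s \<theta> by (simp add: deriv_desing_power powr_power powr_minus_divide power_divide mult.commute)
      have \<sigma>0: "0 < \<sigma>" using s deriv by (simp add: \<sigma>_def angle_sigma_def)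
      have h\<sigma>: "h * s powr (2 * \<theta>) \<le> D u v * \<sigma>"
      proof (cases "r > 0")
        case True
        then show ?thesis using s deriv
          by (auto simp: h_def \<sigma>_def angle_sigma_def s_def intro!: mult_right_mono)
      next
        case False
        then have "r = 0" using r by simp
        then show ?thesis using s deriv
          by (simp add: h_def \<sigma>_def angle_sigma_def s_def)
      qed
      have Duv: "0 \<le> D u v" using s zero_le_power2[of r] unfolding s_def by linarith
      let ?cos = "cos (vec_angle (b k - v) (u - v))"
      have ld: "left_dist f B v = ereal (D u v)"
        using uv seq_proj(1)[of "Suc k"] by (intro left_dist_eq) (auto simp: u_def v_def)
      have "\<gamma> \<le> (1 - ?cos) / \<sigma>"
        using ang[OF seq_block[of k]] inW s elim uv ld
        by (simp add: bregman_eq_D \<sigma>_def s_def flip: u_def v_def)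
      then have 1: "\<gamma> * \<sigma> \<le> 1 - ?cos" using \<sigma>0 by (simp add: field_simps)
      \<comment> \<open>Left optimality of \<open>u\<close> carries the lower bound over to the side
        from \<open>v\<close> to \<open>b k\<close>, so \<open>D u v / M\<close> is admissible for
        both sides.\<close>
      have "D u v \<le> D (b k) v" using seq_min(1)[of "b k" "Suc k"] seq_mem by (simp add: u_def v_def)
      then have 2: "2 * (D u v / M) * (1 - ?cos) \<le> (norm (b k - u))\<^sup>2"
        using M(1) M(2)[of "b k" v] M(2)[of u v] uv seq_mem Duv
        by (intro dist_sq_ge_angle) (auto simp: field_simps intro: order_trans)
      have "c * s powr (2 * \<theta>) = 2 / M * \<gamma> * (h * s powr (2 * \<theta>))" by (simp add: c_def)
      also have "\<dots> \<le> 2 / M * \<gamma> * (D u v * \<sigma>)"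
        using h\<sigma> M W by (intro mult_left_mono) auto
      also have "\<dots> = 2 * (D u v / M) * (\<gamma> * \<sigma>)" by simp
      also have "\<dots> \<le> 2 * (D u v / M) * (1 - ?cos)"
        using 1 M Duv by (intro mult_left_mono) auto
      also note 2
      finally show ?thesis by (simp add: s_def u_def v_def)
    qed
  qed
  moreover have "0 < c" using h M W by (simp add: c_def)
  ultimately show ?thesis using W by blast
qed

text \<open>Every cluster point of the shifted pairs is a gap pair in \<open>K\<close>, where both
  local estimates hold with the smaller of their constants. Both weaken as the constant decreases,
  so compactness applies to their conjunction.\<close>

lemma uniform_descent_and_error_bound:
  assumes gap: "is_gap f A B a b K r" and \<theta>: "\<theta> < 1"
    and three: "\<And>bs as. (bs, as) \<in> K \<Longrightarrow> rl_three_point f A B bs as"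
    and angle: "\<And>bs as. (bs, as) \<in> K \<Longrightarrow> rl_angle_condition f A B (desing_power \<theta>) bs as"
  shows "\<exists>c>0. \<forall>\<^sub>F k in sequentially.
    c * (norm (b k - b (Suc k)))\<^sup>2 \<le> D (b k) (a k) - D (b (Suc k)) (a (Suc k)) \<and>
    c * (D (b (Suc k)) (a (Suc k)) - r\<^sup>2 / 2) powr (2 * \<theta>) \<le> (norm (b k - b (Suc k)))\<^sup>2"
proof (rule compact_cluster_uniform_constant[where S = "B \<times> A" and z = "\<lambda>k. (b (Suc k), a (Suc k))"])
  show "compact (B \<times> A)" using A B by (intro compact_Times)
  show "(b (Suc k), a (Suc k)) \<in> B \<times> A" for k using seq_mem by simp
next
  fix c c' :: real and k
  assume "c * (norm (b k - b (Suc k)))\<^sup>2 \<le> D (b k) (a k) - D (b (Suc k)) (a (Suc k)) \<and>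
      c * (D (b (Suc k)) (a (Suc k)) - r\<^sup>2 / 2) powr (2 * \<theta>) \<le> (norm (b k - b (Suc k)))\<^sup>2"
    and "c' \<le> c"
  then show "c' * (norm (b k - b (Suc k)))\<^sup>2 \<le> D (b k) (a k) - D (b (Suc k)) (a (Suc k)) \<and>
      c' * (D (b (Suc k)) (a (Suc k)) - r\<^sup>2 / 2) powr (2 * \<theta>) \<le> (norm (b k - b (Suc k)))\<^sup>2"
    by (meson mult_right_mono order_trans powr_ge_zero zero_le_power2)
next
  fix x and \<kappa> :: "nat \<Rightarrow> nat"
  assume \<kappa>: "strict_mono \<kappa>" and lim: "((\<lambda>k. (b (Suc k), a (Suc k))) \<circ> \<kappa>) \<longlonglongrightarrow> x"
  obtain bs as where x: "x = (bs, as)" by (cases x)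
  have l: "(\<lambda>n. b (Suc (\<kappa> n))) \<longlonglongrightarrow> bs" "(\<lambda>n. a (Suc (\<kappa> n))) \<longlonglongrightarrow> as"
    using tendsto_fst[OF lim] tendsto_snd[OF lim] by (simp_all add: x comp_def)
  note K = cluster_pair_in_gap[OF gap \<kappa> l]
  obtain c1 W1 where 1: "0 < c1" "open W1" "(bs, as) \<in> W1" "\<And>k. (b (Suc k), a (Suc k)) \<in> W1 \<Longrightarrow>
      c1 * (norm (b k - b (Suc k)))\<^sup>2 \<le> D (b k) (a k) - D (b (Suc k)) (a (Suc k))"
    using three_point_descent[OF three[OF K(1)]] by blast
  obtain c2 W2 where 2: "0 < c2" "open W2" "(bs, as) \<in> W2"
    "\<forall>\<^sub>F k in sequentially. (b (Suc k), a (Suc k)) \<in> W2 \<longrightarrow>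
      c2 * (D (b (Suc k)) (a (Suc k)) - r\<^sup>2 / 2) powr (2 * \<theta>) \<le> (norm (b k - b (Suc k)))\<^sup>2"
    using angle_error_bound[OF gap K(2) \<theta> angle[OF K(1)]] by blast
  have "\<forall>\<^sub>F k in sequentially. (b (Suc k), a (Suc k)) \<in> W1 \<inter> W2 \<longrightarrow>
      min c1 c2 * (norm (b k - b (Suc k)))\<^sup>2 \<le> D (b k) (a k) - D (b (Suc k)) (a (Suc k)) \<and>
      min c1 c2 * (D (b (Suc k)) (a (Suc k)) - r\<^sup>2 / 2) powr (2 * \<theta>) \<le> (norm (b k - b (Suc k)))\<^sup>2"
    using 2(4)
  proof eventually_elim
    case (elim k)
    have "min c1 c2 * (norm (b k - b (Suc k)))\<^sup>2 \<le> c1 * (norm (b k - b (Suc k)))\<^sup>2"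
      by (intro mult_right_mono) auto
    moreover have "min c1 c2 * (D (b (Suc k)) (a (Suc k)) - r\<^sup>2 / 2) powr (2 * \<theta>)
        \<le> c2 * (D (b (Suc k)) (a (Suc k)) - r\<^sup>2 / 2) powr (2 * \<theta>)"
      by (intro mult_right_mono) auto
    ultimately show ?case using elim 1(4)[of k] by fastforce
  qed
  moreover have "open (W1 \<inter> W2)" "x \<in> W1 \<inter> W2" "0 < min c1 c2" using 1 2 x by auto
  ultimately show "\<exists>c W. 0 < c \<and> open W \<and> x \<in> W \<and>
    (\<forall>\<^sub>F k in sequentially. (b (Suc k), a (Suc k)) \<in> W \<longrightarrow>
      c * (norm (b k - b (Suc k)))\<^sup>2 \<le> D (b k) (a k) - D (b (Suc k)) (a (Suc k)) \<and>
      c * (D (b (Suc k)) (a (Suc k)) - r\<^sup>2 / 2) powr (2 * \<theta>) \<le> (norm (b k - b (Suc k)))\<^sup>2)"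
    by blast
qed

end

section \<open>Convergence and rates of the alternating sequence\<close>

theorem corollary9p1:
  fixes f :: "'a::euclidean_space \<Rightarrow> ereal"
    and A B :: "'a set"
    and a b :: "nat \<Rightarrow> 'a"
    and K :: "('a \<times> 'a) set"
    and r \<theta> :: real
  assumes "convex_legendre f"
    and "C2_posdef_on (interior (edom f)) (finite_part f)"
    and "A \<subseteq> interior (edom f)" "A \<noteq> {}" "closed A" "bounded A"
    and "B \<subseteq> interior (edom f)" "B \<noteq> {}" "closed B" "bounded B"
    and "alternating_sequence f A B a b"
    and "is_gap f A B a b K r"
    and "1 / 2 \<le> \<theta>" "\<theta> < 1"
    and "\<And>bs as. (bs, as) \<in> K \<Longrightarrow> rl_three_point f A B bs as"
    and "\<And>bs as. (bs, as) \<in> K \<Longrightarrow> rl_angle_condition f A B (desing_power \<theta>) bs as"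
  shows "\<exists>bs. b \<longlonglongrightarrow> bs \<and>
    (1 / 2 < \<theta> \<longrightarrow>
       0 < (1 - \<theta>) / (2 * \<theta> - 1) \<and>
       (\<lambda>k. norm (b k - bs)) \<in> O(\<lambda>k. real k powr (- ((1 - \<theta>) / (2 * \<theta> - 1))))) \<and>
    (\<theta> = 1 / 2 \<longrightarrow> R_linear b bs) \<and>
    (r = 0 \<longrightarrow>
       bs \<in> A \<inter> B \<and> a \<longlonglongrightarrow> bs \<and>
       (1 / 2 < \<theta> \<longrightarrow>
          (\<lambda>k. norm (a k - bs)) \<in> O(\<lambda>k. real k powr (- ((1 - \<theta>) / (2 * \<theta> - 1))))) \<and>
       (\<theta> = 1 / 2 \<longrightarrow> R_linear a bs))"
proof -
  interpret bregman_alternation f A B a b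
    using assms by unfold_locales (auto simp: compact_eq_bounded_closed)
  note gap = assms(12)
  have \<theta>: "1 / 2 \<le> \<theta>" "\<theta> < 1" by fact+
  obtain c N where c: "0 < c"
    and ev: "\<And>k. N \<le> k \<Longrightarrow>
      c * (norm (b k - b (Suc k)))\<^sup>2 \<le> D (b k) (a k) - D (b (Suc k)) (a (Suc k)) \<and>
      c * (D (b (Suc k)) (a (Suc k)) - r\<^sup>2 / 2) powr (2 * \<theta>) \<le> (norm (b k - b (Suc k)))\<^sup>2"
    using uniform_descent_and_error_bound[OF gap \<theta>(2) assms(15,16)]
    unfolding eventually_sequentially by blast
  \<comment> \<open>The uniform estimates hold only from \<open>N\<close> on, so the analysis runs
    on the tail, and the rate lemmas undo the shift.\<close>
  define s where "s k = D (b (k + N)) (a (k + N)) - r\<^sup>2 / 2" for k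
  have s0: "0 \<le> s k" for k using gap_le_D[OF gap] by (simp add: s_def)
  have descent: "c * (norm (b (k + N) - b (Suc k + N)))\<^sup>2 \<le> s k - s (Suc k)" for k
    using ev[of "k + N"] by (simp add: s_def)
  have error: "c * s (Suc k) powr (2 * \<theta>) \<le> (norm (b (k + N) - b (Suc k + N)))\<^sup>2" for k
    using ev[of "k + N"] by (simp add: s_def)
  \<comment> \<open>Eliminating the squared step between \<open>error\<close> and
    \<open>descent\<close> leaves a recursion in \<open>s\<close> alone.\<close>
  have rec: "c * c * s (Suc k) powr (2 * \<theta>) \<le> s k - s (Suc k)" for k
    using order_trans[OF mult_left_mono[OF error[of k], of c] descent[of k]] c by (simp add: mult.assoc)
  have cc: "0 < c * c" using c by simp
  obtain x C where x: "(\<lambda>k. b (k + N)) \<longlonglongrightarrow> x" and C: "0 < C"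
    and bC: "\<And>k. norm (b (Suc k + N) - x) \<le> C * s k powr (1 - \<theta>)"
    using desingularized_length_bound[where s = s and b = "\<lambda>k. b (k + N)", OF \<theta> c s0 descent error] by blast
  have bx: "b \<longlonglongrightarrow> x" using x by (rule LIMSEQ_offset)
  \<comment> \<open>The shift is \<open>Suc N\<close> because the length bound controls the iterate
    after \<open>k\<close> by \<open>s k\<close>.\<close>
  have bC': "norm (b (k + Suc N) - x) \<le> C * s k powr (1 - \<theta>)" for k
    using bC[of k] by simp
  note b_rates = rates_of_desingularized_error[where s = s and u = b, OF \<theta> cc s0 rec C bC']
  have feasible: "x \<in> A \<inter> B \<and> a \<longlonglongrightarrow> x \<and>
      (1 / 2 < \<theta> \<longrightarrow>
        (\<lambda>k. norm (a k - x)) \<in> O(\<lambda>k. real k powr (- ((1 - \<theta>) / (2 * \<theta> - 1))))) \<and>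
      (\<theta> = 1 / 2 \<longrightarrow> R_linear a x)" if r: "r = 0"
  proof -
    \<comment> \<open>For \<open>r = 0\<close> the value \<open>s\<close> is the full Bregman
      distance, so \<open>norm (b k - a k)\<close> is of order \<open>sqrt s\<close>. This is within
      \<open>s powr (1 - \<theta>)\<close>, and \<open>a\<close> inherits the rate of
      \<open>b\<close>.\<close>
    obtain m where m: "0 < m" "\<And>x y. x \<in> A \<union> B \<Longrightarrow> y \<in> A \<union> B \<Longrightarrow> m * (norm (x - y))\<^sup>2 \<le> D x y"
      using D_quadratic_bounds by blast
    have dec: "s (Suc k) \<le> s k" for k using D_Suc_le by (simp add: s_def)
    have decn: "s k \<le> s 0" for k by (induction k) (use dec order_trans in auto)
    define C' where "C' = s 0 powr (1/2 - (1 - \<theta>)) / sqrt m + C"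
    have C': "0 < C'" using C m by (simp add: C'_def add_nonneg_pos)
    have aC: "norm (a (k + Suc N) - x) \<le> C' * s k powr (1 - \<theta>)" for k
    proof -
      define w where "w = norm (b (k + Suc N) - a (k + Suc N))"
      have "m * w\<^sup>2 \<le> s (Suc k)" using m(2) seq_mem r by (simp add: w_def s_def)
      then have "w\<^sup>2 \<le> s k / m" using m(1) dec[of k] by (simp add: field_simps)
      then have "w \<le> sqrt (s k) / sqrt m" using real_le_rsqrt by (simp flip: real_sqrt_divide)
      also have "\<dots> \<le> s 0 powr (1/2 - (1 - \<theta>)) * s k powr (1 - \<theta>) / sqrt m"
        using sqrt_le_powr_half_split[OF s0 decn, of "1 - \<theta>" k] \<theta> m(1)
        by (intro divide_right_mono) auto
      finally have "w + norm (b (k + Suc N) - x) \<le> C' * s k powr (1 - \<theta>)"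
        using bC'[of k] by (simp add: C'_def algebra_simps)
      moreover have "norm (a (k + Suc N) - x) \<le> w + norm (b (k + Suc N) - x)"
        using norm_triangle_ineq[of "a (k + Suc N) - b (k + Suc N)" "b (k + Suc N) - x"]
        by (simp add: w_def norm_minus_commute)
      ultimately show ?thesis by simp
    qed
    have "(\<lambda>k. D (b k) (a k)) \<longlonglongrightarrow> 0" using D_limit[OF gap] r by simp
    then have "s \<longlonglongrightarrow> 0" unfolding s_def using r LIMSEQ_ignore_initial_segment by simp
    then have "(\<lambda>k. s k powr (1 - \<theta>)) \<longlonglongrightarrow> 0"
      using \<theta> s0 by (intro tendsto_zero_powrI[where b = "1 - \<theta>"]) auto
    then have "(\<lambda>k. C' * s k powr (1 - \<theta>)) \<longlonglongrightarrow> 0" by (rule tendsto_mult_right_zero)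
    then have "(\<lambda>k. a (k + Suc N) - x) \<longlonglongrightarrow> 0"
      by (rule Lim_null_comparison[rotated]) (use aC in auto)
    then have "(\<lambda>k. a (k + Suc N)) \<longlonglongrightarrow> x" by (simp add: LIM_zero_iff)
    then have ax: "a \<longlonglongrightarrow> x" by (rule LIMSEQ_offset)
    moreover have "x \<in> A \<inter> B"
      using closed_sequentially[OF \<open>closed A\<close> _ ax] closed_sequentially[OF \<open>closed B\<close> _ bx] seq_mem
      by auto
    ultimately show ?thesis
      using rates_of_desingularized_error[where s = s and u = a, OF \<theta> cc s0 rec C' aC] by blast
  qed
  show ?thesis
    using bx b_rates feasible \<theta> by (intro exI[of _ x]) auto
qed

end
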